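(* Let $V$ be a countable set, let $r\ge1$ and let $K_r$ be a Markov transition operator on $V$. Let $\pi_r$ and $\pi_{r-1}$ be two positive finite measures on $V$. Assume that $\pi_r$ is an invariant measure for $K_r$ and that $\pi_r(x)\ge\pi_{r-1}(x)$ for all $x\in V$. Let $Q_r=K_r^*K_r$, where $K_r^*$ is the adjoint of $K_r$ on $\ell^2(\pi_r)$. Then $$\forall g\in\ell^2(\pi_r),\quad \mathcal E_{Q_r,\pi_r}(g,g)\le\left\|g-\tilde\pi_r(g)\right\|_{\ell^2(\pi_r)}^2-\left\|K_rg-\tilde\pi_{r-1}(K_rg)\right\|_{\ell^2(\pi_{r-1})}^2.$$
   Context: A Markov transition operator $K$ on $V$ is a map $K:V\times V\to[0,1]$ with $\sum_y K(x,y)=1$ for all $x$; $(Kf)(x)=\sum_yK(x,y)f(y)$; $\pi$ is invariant for $K$ if $\sum_x\pi(x)K(x,y)=\pi(y)$ for all $y$. Positive means $\pi(x)>0$ for all $x$. For a finite measure $\pi$, $\tilde\pi:=\pi/\pi(V)$, $\tilde\pi(f)=\sum_xf(x)\tilde\pi(x)$, $\|f\|_{\ell^2(\pi)}^2=\sum_xf(x)^2\pi(x)$. Dirichlet form: $\mathcal E_{Q,\pi}(f,f)=\langle(I-Q)f,f\rangle_\pi=\frac12\sum_{x,y}(f(x)-f(y))^2Q(x,y)\pi(x)$. *)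

theory Defs
  imports "HOL-Analysis.Analysis" "HOL-Library.Countable"
begin

text \<open>
  The state space is the universe of a type of class \<^class>\<open>countable\<close>. A measure on it is given
  by its point masses.
\<close>

definition positive_finite_measure :: "('v \<Rightarrow> real) \<Rightarrow> bool" where
  "positive_finite_measure \<pi> \<longleftrightarrow> (\<forall>x. \<pi> x > 0) \<and> \<pi> summable_on UNIV"

definition total_mass :: "('v \<Rightarrow> real) \<Rightarrow> real" where
  "total_mass \<pi> = (\<Sum>\<^sub>\<infinity>x. \<pi> x)"

definition normalized :: "('v \<Rightarrow> real) \<Rightarrow> 'v \<Rightarrow> real" where
  "normalized \<pi> x = \<pi> x / total_mass \<pi>"

definition mean :: "('v \<Rightarrow> real) \<Rightarrow> ('v \<Rightarrow> real) \<Rightarrow> real" where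
  "mean \<mu> f = (\<Sum>\<^sub>\<infinity>x. f x * \<mu> x)"

definition l2 :: "('v \<Rightarrow> real) \<Rightarrow> ('v \<Rightarrow> real) set" where
  "l2 \<pi> = {f. (\<lambda>x. (f x)\<^sup>2 * \<pi> x) summable_on UNIV}"

definition l2_inner :: "('v \<Rightarrow> real) \<Rightarrow> ('v \<Rightarrow> real) \<Rightarrow> ('v \<Rightarrow> real) \<Rightarrow> real" where
  "l2_inner \<pi> f g = (\<Sum>\<^sub>\<infinity>x. f x * g x * \<pi> x)"

definition l2_norm :: "('v \<Rightarrow> real) \<Rightarrow> ('v \<Rightarrow> real) \<Rightarrow> real" where
  "l2_norm \<pi> f = sqrt (\<Sum>\<^sub>\<infinity>x. (f x)\<^sup>2 * \<pi> x)"

definition markov_kernel :: "('v \<Rightarrow> 'v \<Rightarrow> real) \<Rightarrow> bool" where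
  "markov_kernel K \<longleftrightarrow> (\<forall>x y. K x y \<in> {0..1}) \<and> (\<forall>x. (K x has_sum 1) UNIV)"

definition kernel_op :: "('v \<Rightarrow> 'v \<Rightarrow> real) \<Rightarrow> ('v \<Rightarrow> real) \<Rightarrow> 'v \<Rightarrow> real" where
  "kernel_op K f x = (\<Sum>\<^sub>\<infinity>y. K x y * f y)"

definition invariant_measure :: "('v \<Rightarrow> 'v \<Rightarrow> real) \<Rightarrow> ('v \<Rightarrow> real) \<Rightarrow> bool" where
  "invariant_measure K \<pi> \<longleftrightarrow> (\<forall>y. ((\<lambda>x. \<pi> x * K x y) has_sum \<pi> y) UNIV)"

text \<open>
  The Hilbert space adjoint of an operator \<open>T\<close> on \<open>l2 \<pi>\<close>, meaningful on arguments in \<open>l2 \<pi>\<close>.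
  Positivity of \<open>\<pi>\<close> makes the function described unique; it exists if \<open>T\<close> is a bounded
  linear operator on \<open>l2 \<pi>\<close>.
\<close>

definition l2_adjoint ::
    "('v \<Rightarrow> real) \<Rightarrow> (('v \<Rightarrow> real) \<Rightarrow> 'v \<Rightarrow> real) \<Rightarrow> ('v \<Rightarrow> real) \<Rightarrow> 'v \<Rightarrow> real" where
  "l2_adjoint \<pi> T g =
     (THE h. h \<in> l2 \<pi> \<and> (\<forall>f \<in> l2 \<pi>. l2_inner \<pi> (T f) g = l2_inner \<pi> f h))"

definition dirichlet_form ::
    "(('v \<Rightarrow> real) \<Rightarrow> 'v \<Rightarrow> real) \<Rightarrow> ('v \<Rightarrow> real) \<Rightarrow> ('v \<Rightarrow> real) \<Rightarrow> ('v \<Rightarrow> real) \<Rightarrow> real" where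
  "dirichlet_form Q \<pi> f g = l2_inner \<pi> (\<lambda>x. f x - Q f x) g"

end

theory Submission
  imports Defs
begin

text \<open>
  The reversed kernel \<open>\<pi> x * K x y / \<pi> y\<close> is again Markov with invariant measure \<open>\<pi>\<close> and realises
  the adjoint, so \<open>\<langle>Q g, g\<rangle> = \<parallel>K g\<parallel>\<^sup>2\<close> and the Dirichlet form equals
  \<open>\<parallel>g\<parallel>\<^sup>2 - \<parallel>K g\<parallel>\<^sup>2\<close>. Invariance gives \<open>K g\<close> the same \<open>\<pi>\<close>-mean \<open>m\<close> as \<open>g\<close>, so this is also
  \<open>\<parallel>g - m\<parallel>\<^sup>2 - \<parallel>K g - m\<parallel>\<^sup>2\<close>. Finally \<open>\<parallel>K g - m\<parallel>\<^sup>2\<close> only decreases when the measure is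
  replaced by a smaller one and \<open>m\<close> by the mean for that measure, which minimises the
  quadratic deviation.
\<close>

section \<open>Square-summable functions and quadratic deviations\<close>

lemma has_sum_diff:
  fixes f g :: "'a \<Rightarrow> 'b :: topological_ab_group_add"
  assumes "(f has_sum a) A" "(g has_sum b) A"
  shows "((\<lambda>x. f x - g x) has_sum (a - b)) A"
  using has_sum_add[OF assms(1), of "\<lambda>x. - g x" "- b"] assms(2) by (simp add: has_sum_uminus)

text \<open>The bound \<open>|f g| \<le> f^2 + g^2\<close> supplies a dominating series. The weight
  is an arbitrary nonnegative function, so that rows of a kernel and weights on pairs of states are
  covered too.\<close>

lemma l2_mult_summable:
  fixes \<mu> :: "'a \<Rightarrow> real"
  assumes "\<And>x. \<mu> x \<ge> 0" "f \<in> l2 \<mu>" "g \<in> l2 \<mu>"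
  shows "(\<lambda>x. f x * g x * \<mu> x) summable_on UNIV"
proof (rule abs_summable_summable, rule summable_on_comparison_test)
  show "(\<lambda>x. (f x)\<^sup>2 * \<mu> x + (g x)\<^sup>2 * \<mu> x) summable_on UNIV"
    using assms by (auto simp: l2_def intro: summable_on_add)
next
  fix x
  have "0 \<le> (\<bar>f x\<bar> - \<bar>g x\<bar>)\<^sup>2" "0 \<le> \<bar>f x\<bar> * \<bar>g x\<bar>" by simp_all
  hence "\<bar>f x\<bar> * \<bar>g x\<bar> \<le> (f x)\<^sup>2 + (g x)\<^sup>2"
    unfolding power2_diff power2_abs by linarith
  from mult_right_mono[OF this assms(1)[of x]] assms(1)[of x]
  show "norm (f x * g x * \<mu> x) \<le> (f x)\<^sup>2 * \<mu> x + (g x)\<^sup>2 * \<mu> x"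
    by (simp add: abs_mult algebra_simps)
qed auto

lemma const_in_l2:
  assumes "\<mu> summable_on UNIV"
  shows "(\<lambda>_. c) \<in> l2 \<mu>"
  using assms by (auto simp: l2_def intro: summable_on_cmult_right)

lemma l2_mono:
  assumes "\<And>x. 0 \<le> \<nu> x" "\<And>x. \<nu> x \<le> \<mu> x"
  shows "l2 \<mu> \<subseteq> l2 \<nu>"
proof
  fix f assume "f \<in> l2 \<mu>"
  hence "(\<lambda>x. (f x)\<^sup>2 * \<mu> x) summable_on UNIV" by (simp add: l2_def)
  hence "(\<lambda>x. (f x)\<^sup>2 * \<nu> x) summable_on UNIV"
    by (rule summable_on_comparison_test) (use assms in \<open>auto intro: mult_left_mono\<close>)
  thus "f \<in> l2 \<nu>" by (simp add: l2_def)
qed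

text \<open>Expand the square: finite mass makes constants square summable, hence the linear term
  converges. The mass is left general, since the lemma serves both the measures and the rows of a
  kernel.\<close>

lemma square_deviation_has_sum:
  fixes \<mu> :: "'a \<Rightarrow> real"
  assumes nn: "\<And>x. \<mu> x \<ge> 0" and sm: "\<mu> summable_on UNIV" and f: "f \<in> l2 \<mu>"
  shows "((\<lambda>x. (f x - c)\<^sup>2 * \<mu> x) has_sum
           ((\<Sum>\<^sub>\<infinity>x. (f x)\<^sup>2 * \<mu> x) - 2 * c * (\<Sum>\<^sub>\<infinity>x. f x * \<mu> x) + c\<^sup>2 * total_mass \<mu>)) UNIV"
proof -
  have "((\<lambda>x. (f x)\<^sup>2 * \<mu> x) has_sum (\<Sum>\<^sub>\<infinity>x. (f x)\<^sup>2 * \<mu> x)) UNIV"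
    using f by (simp add: l2_def)
  moreover have "(\<lambda>x. f x * \<mu> x) summable_on UNIV"
    using l2_mult_summable[OF nn f const_in_l2[OF sm, of 1]] by simp
  hence "((\<lambda>x. 2 * c * (f x * \<mu> x)) has_sum 2 * c * (\<Sum>\<^sub>\<infinity>x. f x * \<mu> x)) UNIV"
    by (intro has_sum_cmult_right) simp
  moreover have "((\<lambda>x. c\<^sup>2 * \<mu> x) has_sum c\<^sup>2 * total_mass \<mu>) UNIV"
    unfolding total_mass_def using sm by (intro has_sum_cmult_right) simp
  ultimately have "((\<lambda>x. (f x)\<^sup>2 * \<mu> x - 2 * c * (f x * \<mu> x) + c\<^sup>2 * \<mu> x) has_sum
       ((\<Sum>\<^sub>\<infinity>x. (f x)\<^sup>2 * \<mu> x) - 2 * c * (\<Sum>\<^sub>\<infinity>x. f x * \<mu> x) + c\<^sup>2 * total_mass \<mu>)) UNIV"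
    by (intro has_sum_add has_sum_diff)
  thus ?thesis by (simp add: power2_diff algebra_simps)
qed

lemma l2_norm_power2:
  assumes "\<And>x. \<mu> x \<ge> 0"
  shows "(l2_norm \<mu> f)\<^sup>2 = (\<Sum>\<^sub>\<infinity>x. (f x)\<^sup>2 * \<mu> x)"
  unfolding l2_norm_def using assms by (intro real_sqrt_pow2 infsum_nonneg) simp

lemma mean_normalized: "mean (normalized \<mu>) f = (\<Sum>\<^sub>\<infinity>x. f x * \<mu> x) / total_mass \<mu>"
  unfolding mean_def normalized_def times_divide_eq_right divide_inverse mult.assoc[symmetric]
  by (rule infsum_cmult_left')

lemma positive_finite_measure_total_mass:
  assumes "positive_finite_measure \<mu>"
  shows "total_mass \<mu> > 0"
proof -
  have pos: "\<And>x. \<mu> x > 0" and sm: "\<mu> summable_on UNIV"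
    using assms by (auto simp: positive_finite_measure_def)
  \<comment> \<open>Types are nonempty, so \<open>undefined\<close> serves as a sample state whose
    mass bounds the total from below.\<close>
  have "0 < \<mu> undefined" by (rule pos)
  also have "\<dots> = infsum \<mu> {undefined}" by simp
  also have "\<dots> \<le> infsum \<mu> UNIV"
    by (intro infsum_mono_neutral sm) (auto simp: less_imp_le pos)
  finally show ?thesis by (simp add: total_mass_def)
qed

lemma variance_eq:
  assumes \<mu>: "positive_finite_measure \<mu>" and f: "f \<in> l2 \<mu>"
  shows "(l2_norm \<mu> (\<lambda>x. f x - mean (normalized \<mu>) f))\<^sup>2 =
           (\<Sum>\<^sub>\<infinity>x. (f x)\<^sup>2 * \<mu> x) - (\<Sum>\<^sub>\<infinity>x. f x * \<mu> x)\<^sup>2 / total_mass \<mu>"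
proof -
  have nn: "\<And>x. \<mu> x \<ge> 0" and sm: "\<mu> summable_on UNIV"
    using \<mu> by (auto simp: positive_finite_measure_def less_imp_le)
  have M: "total_mass \<mu> > 0" by (rule positive_finite_measure_total_mass[OF \<mu>])
  show ?thesis
    unfolding l2_norm_power2[OF nn] infsumI[OF square_deviation_has_sum[OF nn sm f]] mean_normalized
    using M by (simp add: field_simps power2_eq_square)
qed

text \<open>With \<open>S\<close> the integral of \<open>f\<close> and \<open>M\<close> the total
  mass, the gap between the two sides is exactly \<open>(S - c * M)^2 / M\<close>.\<close>

lemma variance_le_square_deviation:
  assumes \<mu>: "positive_finite_measure \<mu>" and f: "f \<in> l2 \<mu>"
  shows "(l2_norm \<mu> (\<lambda>x. f x - mean (normalized \<mu>) f))\<^sup>2 \<le> (\<Sum>\<^sub>\<infinity>x. (f x - c)\<^sup>2 * \<mu> x)"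
proof -
  have nn: "\<And>x. \<mu> x \<ge> 0" and sm: "\<mu> summable_on UNIV"
    using \<mu> by (auto simp: positive_finite_measure_def less_imp_le)
  have M: "total_mass \<mu> > 0" by (rule positive_finite_measure_total_mass[OF \<mu>])
  define S where "S = (\<Sum>\<^sub>\<infinity>x. f x * \<mu> x)"
  have "0 \<le> (S - c * total_mass \<mu>)\<^sup>2 / total_mass \<mu>" using M by simp
  also have "\<dots> = S\<^sup>2 / total_mass \<mu> - 2 * c * S + c\<^sup>2 * total_mass \<mu>"
    using M by (simp add: field_simps power2_eq_square)
  finally show ?thesis
    unfolding variance_eq[OF \<mu> f] infsumI[OF square_deviation_has_sum[OF nn sm f]]
      S_def[symmetric] by linarith
qed

section \<open>Time reversal of a stationary kernel\<close>

definition reversed_kernel :: "('v \<Rightarrow> real) \<Rightarrow> ('v \<Rightarrow> 'v \<Rightarrow> real) \<Rightarrow> 'v \<Rightarrow> 'v \<Rightarrow> real" where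
  "reversed_kernel \<pi> K y x = \<pi> x * K x y / \<pi> y"

text \<open>Bundling the hypotheses lets every result be instantiated for the reversed kernel as
  well.\<close>

locale stationary_kernel =
  fixes K :: "'v \<Rightarrow> 'v \<Rightarrow> real" and \<pi> :: "'v \<Rightarrow> real"
  assumes markov: "markov_kernel K"
    and pfm: "positive_finite_measure \<pi>"
    and invariant: "invariant_measure K \<pi>"
begin

lemma pi_pos: "\<pi> x > 0" and pi_summable: "\<pi> summable_on UNIV"
  using pfm by (auto simp: positive_finite_measure_def)

lemma pi_nonneg: "\<pi> x \<ge> 0"
  using pi_pos[of x] by simp

lemma K_nonneg: "K x y \<ge> 0" and K_has_sum: "(K x has_sum 1) UNIV"
  using markov by (auto simp: markov_kernel_def)

lemma invariant_has_sum: "((\<lambda>x. \<pi> x * K x y) has_sum \<pi> y) UNIV"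
  using invariant by (simp add: invariant_measure_def)

text \<open>The left side is a single term of the nonnegative invariance sum for
  \<open>\<pi> y\<close>. This bounds the reversed kernel by 1 and each weighted row by
  \<open>\<pi>\<close>.\<close>

lemma weight_le: "\<pi> x * K x y \<le> \<pi> y"
proof -
  have "\<pi> x * K x y = infsum (\<lambda>x. \<pi> x * K x y) {x}" by simp
  also have "\<dots> \<le> infsum (\<lambda>x. \<pi> x * K x y) UNIV"
    by (intro infsum_mono_neutral has_sum_imp_summable[OF invariant_has_sum])
      (auto simp: pi_nonneg K_nonneg)
  finally show ?thesis by (simp add: infsumI[OF invariant_has_sum])
qed

text \<open>Reversal exchanges the two sum conditions: invariance of \<open>\<pi>\<close> becomes
  the unit row sums, and the unit row sums of \<open>K\<close> become invariance.\<close>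

lemma stationary_reversed: "stationary_kernel (reversed_kernel \<pi> K) \<pi>"
proof
  have "reversed_kernel \<pi> K y x \<in> {0..1}" for x y
    using weight_le[of x y] pi_pos[of y] pi_nonneg[of x] K_nonneg[of x y]
    by (simp add: reversed_kernel_def)
  moreover have "(reversed_kernel \<pi> K y has_sum 1) UNIV" for y
    using has_sum_cmult_left[OF invariant_has_sum[of y], of "inverse (\<pi> y)"] pi_pos[of y]
    by (simp add: reversed_kernel_def[abs_def] divide_inverse)
  ultimately show "markov_kernel (reversed_kernel \<pi> K)"
    by (simp add: markov_kernel_def)
  have "((\<lambda>y. \<pi> y * reversed_kernel \<pi> K y x) has_sum \<pi> x) UNIV" for x
    using has_sum_cmult_right[OF K_has_sum[of x], of "\<pi> x"] pi_pos
    by (simp add: reversed_kernel_def less_imp_neq[THEN not_sym])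
  thus "invariant_measure (reversed_kernel \<pi> K) \<pi>"
    by (simp add: invariant_measure_def)
qed (rule pfm)

section \<open>The kernel as an operator on square-summable functions\<close>

text \<open>Row \<open>x\<close> scaled by \<open>\<pi> x\<close> is dominated by
  \<open>\<pi>\<close>, and the positive factor \<open>\<pi> x\<close> can be divided out.\<close>

lemma row_in_l2:
  assumes "f \<in> l2 \<pi>"
  shows "f \<in> l2 (K x)"
proof -
  have "f \<in> l2 (\<lambda>y. \<pi> x * K x y)"
    using l2_mono[of "\<lambda>y. \<pi> x * K x y" \<pi>] assms weight_le pi_nonneg K_nonneg by auto
  hence "(\<lambda>y. \<pi> x * ((f y)\<^sup>2 * K x y)) summable_on UNIV"
    by (simp add: l2_def mult_ac)
  thus ?thesis
    using pi_pos[of x] by (simp add: l2_def summable_on_cmult_right')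
qed

text \<open>The variance of \<open>f\<close> under the probability weights \<open>K x\<close> is
  nonnegative.\<close>

lemma jensen_square:
  assumes "f \<in> l2 \<pi>"
  shows "(kernel_op K f x)\<^sup>2 \<le> (\<Sum>\<^sub>\<infinity>y. (f y)\<^sup>2 * K x y)"
proof -
  define m where "m = kernel_op K f x"
  have M: "total_mass (K x) = 1" by (simp add: total_mass_def infsumI[OF K_has_sum])
  have m: "(\<Sum>\<^sub>\<infinity>y. f y * K x y) = m" by (simp add: m_def kernel_op_def mult.commute)
  have "0 \<le> (\<Sum>\<^sub>\<infinity>y. (f y - m)\<^sup>2 * K x y)" by (intro infsum_nonneg) (simp add: K_nonneg)
  also have "\<dots> = (\<Sum>\<^sub>\<infinity>y. (f y)\<^sup>2 * K x y) - 2 * m * m + m\<^sup>2"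
    using infsumI[OF square_deviation_has_sum[OF K_nonneg
          has_sum_imp_summable[OF K_has_sum] row_in_l2[OF assms]]] M m by simp
  finally show ?thesis by (simp add: power2_eq_square m_def)
qed

lemma weighted_summable_fst:
  assumes "f \<in> l2 \<pi>"
  shows "(\<lambda>(x, y). (f x)\<^sup>2 * (\<pi> x * K x y)) summable_on UNIV \<times> UNIV"
proof (rule summable_on_SigmaI[where g = "\<lambda>x. (f x)\<^sup>2 * \<pi> x"])
  show "((\<lambda>y. case (x, y) of (x, y) \<Rightarrow> (f x)\<^sup>2 * (\<pi> x * K x y)) has_sum (f x)\<^sup>2 * \<pi> x) UNIV" for x
    using has_sum_cmult_right[OF K_has_sum[of x], of "(f x)\<^sup>2 * \<pi> x"] by (simp add: mult.assoc)
  show "(\<lambda>x. (f x)\<^sup>2 * \<pi> x) summable_on UNIV" using assms by (simp add: l2_def)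
qed (simp add: pi_nonneg K_nonneg)

text \<open>This is the preceding lemma for the reversed kernel, with the coordinates
  exchanged.\<close>

lemma weighted_summable_snd:
  assumes "f \<in> l2 \<pi>"
  shows "(\<lambda>(x, y). (f y)\<^sup>2 * (\<pi> x * K x y)) summable_on UNIV \<times> UNIV"
proof -
  interpret rev: stationary_kernel "reversed_kernel \<pi> K" \<pi> by (rule stationary_reversed)
  have "\<pi> y * reversed_kernel \<pi> K y x = \<pi> x * K x y" for x y
    using pi_pos[of y] by (simp add: reversed_kernel_def)
  with rev.weighted_summable_fst[OF assms]
  have "(\<lambda>(y, x). (f y)\<^sup>2 * (\<pi> x * K x y)) summable_on UNIV \<times> UNIV" by simp
  thus ?thesis by (subst summable_on_swap) simp
qed

text \<open>Jensen's inequality in each row bounds the series by the row sums of a summable family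
  on pairs.\<close>

lemma kernel_op_in_l2:
  assumes "f \<in> l2 \<pi>"
  shows "kernel_op K f \<in> l2 \<pi>"
proof -
  have "(\<lambda>x. \<Sum>\<^sub>\<infinity>y. (f y)\<^sup>2 * (\<pi> x * K x y)) summable_on UNIV"
    using summable_on_Sigma_banach[OF weighted_summable_snd[OF assms]] by simp
  hence "(\<lambda>x. (kernel_op K f x)\<^sup>2 * \<pi> x) summable_on UNIV"
  proof (rule summable_on_comparison_test)
    fix x
    have "(kernel_op K f x)\<^sup>2 * \<pi> x \<le> (\<Sum>\<^sub>\<infinity>y. (f y)\<^sup>2 * K x y) * \<pi> x"
      by (intro mult_right_mono jensen_square assms pi_nonneg)
    also have "\<dots> = (\<Sum>\<^sub>\<infinity>y. (f y)\<^sup>2 * (\<pi> x * K x y))"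
      by (subst infsum_cmult_left'[symmetric]) (simp add: mult_ac)
    finally show "(kernel_op K f x)\<^sup>2 * \<pi> x \<le> (\<Sum>\<^sub>\<infinity>y. (f y)\<^sup>2 * (\<pi> x * K x y))" .
  qed (simp add: pi_nonneg)
  thus ?thesis by (simp add: l2_def)
qed

section \<open>The adjoint and the Dirichlet form\<close>

lemma l2_inner_kernel_op:
  assumes f: "f \<in> l2 \<pi>" and g: "g \<in> l2 \<pi>"
  shows "l2_inner \<pi> (kernel_op K f) g = l2_inner \<pi> f (kernel_op (reversed_kernel \<pi> K) g)"
proof -
  \<comment> \<open>\<open>w\<close> is the unnormalised joint law of one step started from
    \<open>\<pi>\<close>. On pairs, \<open>f\<close> of the second and \<open>g\<close> of the first
    coordinate are square summable for \<open>w\<close>, so their product is summable and the sums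
    may be interchanged.\<close>
  define w where "w = (\<lambda>(x, y). \<pi> x * K x y)"
  have "(\<lambda>p. f (snd p) * g (fst p) * w p) summable_on UNIV"
    using weighted_summable_fst[OF g] weighted_summable_snd[OF f]
    by (intro l2_mult_summable)
      (auto simp: l2_def w_def case_prod_unfold pi_nonneg K_nonneg)
  hence sm: "(\<lambda>(x, y). f y * g x * (\<pi> x * K x y)) summable_on UNIV \<times> UNIV"
    by (simp add: w_def case_prod_unfold)
  have "l2_inner \<pi> (kernel_op K f) g = (\<Sum>\<^sub>\<infinity>x. \<Sum>\<^sub>\<infinity>y. f y * g x * (\<pi> x * K x y))"
    unfolding l2_inner_def kernel_op_def mult.assoc
    by (subst infsum_cmult_left'[symmetric]) (simp add: mult_ac)
  also have "\<dots> = (\<Sum>\<^sub>\<infinity>y. \<Sum>\<^sub>\<infinity>x. f y * g x * (\<pi> x * K x y))"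
    by (rule infsum_swap_banach[OF sm])
  also have "\<dots> = (\<Sum>\<^sub>\<infinity>y. \<Sum>\<^sub>\<infinity>x. f y * \<pi> y * (reversed_kernel \<pi> K y x * g x))"
    using pi_pos by (simp add: reversed_kernel_def less_imp_neq[THEN not_sym] mult_ac)
  also have "\<dots> = l2_inner \<pi> f (kernel_op (reversed_kernel \<pi> K) g)"
    unfolding l2_inner_def kernel_op_def infsum_cmult_right' by (simp add: mult_ac)
  finally show ?thesis .
qed

lemma l2_adjoint_kernel_op:
  assumes g: "g \<in> l2 \<pi>"
  shows "l2_adjoint \<pi> (kernel_op K) g = kernel_op (reversed_kernel \<pi> K) g"
  unfolding l2_adjoint_def
proof (rule the_equality)
  interpret rev: stationary_kernel "reversed_kernel \<pi> K" \<pi> by (rule stationary_reversed)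
  let ?a = "kernel_op (reversed_kernel \<pi> K) g"
  show "?a \<in> l2 \<pi> \<and> (\<forall>f\<in>l2 \<pi>. l2_inner \<pi> (kernel_op K f) g = l2_inner \<pi> f ?a)"
    using rev.kernel_op_in_l2 l2_inner_kernel_op g by blast
  fix h assume h: "h \<in> l2 \<pi> \<and> (\<forall>f\<in>l2 \<pi>. l2_inner \<pi> (kernel_op K f) g = l2_inner \<pi> f h)"
  show "h = ?a"
  proof
    fix y
    \<comment> \<open>For uniqueness, pairing with the indicator of \<open>y\<close> reads off the
      value at \<open>y\<close> times \<open>\<pi> y\<close>, a positive factor that
      cancels.\<close>
    let ?\<delta> = "\<lambda>x::'v. if x = y then 1 else 0 :: real"
    have point: "l2_inner \<pi> ?\<delta> k = k y * \<pi> y" for k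
    proof -
      have "l2_inner \<pi> ?\<delta> k = infsum (\<lambda>x. k x * \<pi> x) {y}"
        unfolding l2_inner_def by (rule infsum_cong_neutral) auto
      thus ?thesis by simp
    qed
    have "(\<lambda>x. (?\<delta> x)\<^sup>2 * \<pi> x) summable_on UNIV"
      by (rule summable_on_comparison_test[OF pi_summable]) (auto simp: pi_nonneg)
    hence "?\<delta> \<in> l2 \<pi>" by (simp add: l2_def)
    hence "l2_inner \<pi> ?\<delta> h = l2_inner \<pi> ?\<delta> ?a"
      using h l2_inner_kernel_op[OF _ g] by metis
    thus "h y = ?a y" using pi_pos[of y] by (simp add: point)
  qed
qed

lemma dirichlet_form_adjoint_comp:
  assumes g: "g \<in> l2 \<pi>"
  shows "dirichlet_form (l2_adjoint \<pi> (kernel_op K) \<circ> kernel_op K) \<pi> g g =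
           (\<Sum>\<^sub>\<infinity>x. (g x)\<^sup>2 * \<pi> x) - (\<Sum>\<^sub>\<infinity>x. (kernel_op K g x)\<^sup>2 * \<pi> x)"
proof -
  interpret rev: stationary_kernel "reversed_kernel \<pi> K" \<pi> by (rule stationary_reversed)
  let ?q = "kernel_op (reversed_kernel \<pi> K) (kernel_op K g)"
  have Kg: "kernel_op K g \<in> l2 \<pi>" by (rule kernel_op_in_l2[OF g])
  have q: "?q \<in> l2 \<pi>" by (rule rev.kernel_op_in_l2[OF Kg])
  have "dirichlet_form (l2_adjoint \<pi> (kernel_op K) \<circ> kernel_op K) \<pi> g g =
          (\<Sum>\<^sub>\<infinity>x. g x * g x * \<pi> x - g x * ?q x * \<pi> x)"
    by (simp add: dirichlet_form_def l2_inner_def l2_adjoint_kernel_op[OF Kg] algebra_simps)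
  also have "\<dots> = l2_inner \<pi> g g - l2_inner \<pi> g ?q"
    unfolding l2_inner_def by (intro infsumI has_sum_diff has_sum_infsum l2_mult_summable pi_nonneg g q)
  also have "l2_inner \<pi> g ?q = l2_inner \<pi> (kernel_op K g) (kernel_op K g)"
    by (rule l2_inner_kernel_op[OF g Kg, symmetric])
  finally show ?thesis unfolding l2_inner_def power2_eq_square .
qed

text \<open>Test the adjoint identity against the constant 1, which lies in \<open>l2 \<pi>\<close>
  by finite mass and is fixed by the reversed kernel.\<close>

lemma infsum_kernel_op:
  assumes g: "g \<in> l2 \<pi>"
  shows "(\<Sum>\<^sub>\<infinity>x. kernel_op K g x * \<pi> x) = (\<Sum>\<^sub>\<infinity>x. g x * \<pi> x)"
proof -
  interpret rev: stationary_kernel "reversed_kernel \<pi> K" \<pi> by (rule stationary_reversed)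
  have "kernel_op (reversed_kernel \<pi> K) (\<lambda>_. 1) = (\<lambda>_. 1)"
    by (simp add: kernel_op_def[abs_def] infsumI[OF rev.K_has_sum])
  thus ?thesis
    using l2_inner_kernel_op[OF g const_in_l2[OF pi_summable, of 1]] by (simp add: l2_inner_def)
qed

section \<open>Comparison of the two variances\<close>

theorem dirichlet_form_le_variance_diff:
  assumes \<nu>: "positive_finite_measure \<nu>" and le: "\<And>x. \<nu> x \<le> \<pi> x" and g: "g \<in> l2 \<pi>"
  shows "dirichlet_form (l2_adjoint \<pi> (kernel_op K) \<circ> kernel_op K) \<pi> g g
           \<le> (l2_norm \<pi> (\<lambda>x. g x - mean (normalized \<pi>) g))\<^sup>2
             - (l2_norm \<nu> (\<lambda>x. kernel_op K g x - mean (normalized \<nu>) (kernel_op K g)))\<^sup>2"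
proof -
  \<comment> \<open>Any centre bounds the variance under \<open>\<nu>\<close> from above. The
    \<open>\<pi>\<close>-mean is chosen so that, after enlarging \<open>\<nu>\<close> to
    \<open>\<pi>\<close>, the bound is exactly the variance under \<open>\<pi>\<close>.\<close>
  let ?m = "mean (normalized \<pi>) (kernel_op K g)"
  have \<nu>_nonneg: "\<nu> x \<ge> 0" and \<nu>_summable: "\<nu> summable_on UNIV" for x
    using \<nu> by (auto simp: positive_finite_measure_def less_imp_le)
  have Kg: "kernel_op K g \<in> l2 \<pi>" by (rule kernel_op_in_l2[OF g])
  have Kg_\<nu>: "kernel_op K g \<in> l2 \<nu>" using l2_mono[of \<nu> \<pi>] \<nu>_nonneg le Kg by blast
  have "(l2_norm \<nu> (\<lambda>x. kernel_op K g x - mean (normalized \<nu>) (kernel_op K g)))\<^sup>2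
          \<le> (\<Sum>\<^sub>\<infinity>x. (kernel_op K g x - ?m)\<^sup>2 * \<nu> x)"
    by (rule variance_le_square_deviation[OF \<nu> Kg_\<nu>])
  also have "\<dots> \<le> (\<Sum>\<^sub>\<infinity>x. (kernel_op K g x - ?m)\<^sup>2 * \<pi> x)"
    by (intro infsum_mono mult_left_mono le zero_le_power2
        has_sum_imp_summable[OF square_deviation_has_sum] \<nu>_nonneg \<nu>_summable Kg_\<nu>
        pi_nonneg pi_summable Kg)
  \<comment> \<open>Equality of the integrals of \<open>K g\<close> and \<open>g\<close> makes the
    subtracted term the one in the variance of \<open>g\<close>, so the two cancel in the
    difference.\<close>
  also have "\<dots> = (\<Sum>\<^sub>\<infinity>x. (kernel_op K g x)\<^sup>2 * \<pi> x) - (\<Sum>\<^sub>\<infinity>x. g x * \<pi> x)\<^sup>2 / total_mass \<pi>"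
    using variance_eq[OF pfm Kg] by (simp add: l2_norm_power2[OF pi_nonneg] infsum_kernel_op[OF g])
  finally show ?thesis
    unfolding dirichlet_form_adjoint_comp[OF g] variance_eq[OF pfm g] by linarith
qed

end

theorem proposition3p10:
  fixes K :: "nat \<Rightarrow> 'v::countable \<Rightarrow> 'v \<Rightarrow> real"
    and \<pi> :: "nat \<Rightarrow> 'v \<Rightarrow> real"
    and Q :: "('v \<Rightarrow> real) \<Rightarrow> 'v \<Rightarrow> real"
    and r :: nat
  assumes "r \<ge> 1"
    and "markov_kernel (K r)"
    and "positive_finite_measure (\<pi> r)"
    and "positive_finite_measure (\<pi> (r - 1))"
    and "invariant_measure (K r) (\<pi> r)"
    and "\<forall>x. \<pi> r x \<ge> \<pi> (r - 1) x"
    and "Q = l2_adjoint (\<pi> r) (kernel_op (K r)) \<circ> kernel_op (K r)"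
  shows "\<forall>g \<in> l2 (\<pi> r).
    dirichlet_form Q (\<pi> r) g g
      \<le> (l2_norm (\<pi> r) (\<lambda>x. g x - mean (normalized (\<pi> r)) g))\<^sup>2
        - (l2_norm (\<pi> (r - 1))
             (\<lambda>x. kernel_op (K r) g x
                  - mean (normalized (\<pi> (r - 1))) (kernel_op (K r) g)))\<^sup>2"
proof -
  interpret stationary_kernel "K r" "\<pi> r"
    using assms by unfold_locales
  show ?thesis
    unfolding assms(7) using assms by (intro ballI dirichlet_form_le_variance_diff) auto
qed

end
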